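(* Let $x=(x_n)_{n\in\mathbb{N}}$ and $y=(y_n)_{n\in\mathbb{N}}$ be two sequences in $\mathbb{K}$. Then: (i) If $x,y\in c$, then $x\perp_B y$ if and only if $0\in\operatorname{conv}\left(\{\overline{x_n}y_n:|x_n|=\|x\|\}\cup\{\lim\overline{x}y\}\right)$, if $\lim|x|=\|x\|$, and $0\in\operatorname{conv}\{\overline{x_n}y_n:|x_n|=\|x\|\}$, if $\lim|x|\neq\|x\|$. In particular, for $\mathbb{K}=\mathbb{R}$, $x\perp_B y$ if and only if any of the following is true: (1) there exists $N\in\mathbb{N}$ such that $|x_N|=\|x\|$ and $y_N=0$, or $\lim|x|=\|x\|$ and $\lim y=0$; (2) there exists $N\in\mathbb{N}$ such that $|x_N|=\lim|x|=\|x\|$ and $x_Ny_N$ and $\lim xy$ are of different signs; (3) there exist $N,M\in\mathbb{N}$ such that $|x_N|=|x_M|=\|x\|$ and $x_Ny_N<0<x_My_M$. (ii) If $x,y\in c_0$ or $c_{00}$, then $x\perp_B y$ if and only if $0\in\operatorname{conv}\{\overline{x_n}y_n:|x_n|=\|x\|\}$. In particular, for $\mathbb{K}=\mathbb{R}$, $x\perp_B y$ if and only if one of the following holds: (1) there exists $N\in\mathbb{N}$ such that $|x_N|=\|x\|$ and $y_N=0$; (2) there exist $N,M\in\mathbb{N}$ such that $|x_N|=|x_M|=\|x\|$ and $x_Ny_N<0<x_My_M$.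
   Context: $\mathbb{K}$ is $\mathbb{R}$ or $\mathbb{C}$. $c$, $c_0$ and $c_{00}$ are the spaces of convergent, convergent-to-zero and eventually zero sequences in $\mathbb{K}$ respectively, each regarded as a subspace of $\ell_\infty$ (the bounded sequences) with the supremum norm $\|\cdot\|$. For $x=(x_n)\in c$, $\lim x$ denotes the limit of $x$; $|x|=(|x_n|)$, $xy=(x_ny_n)$ and $\overline{x}y=(\overline{x_n}y_n)$ are formed termwise. $x\perp_B y$ (Birkhoff-James orthogonality) means $\|x+\lambda y\|\ge\|x\|$ for all $\lambda\in\mathbb{K}$. $\operatorname{conv}$ denotes the convex hull.
   Formalization: In the "in particular" clauses for K = R, x ≠ 0 is assumed in (i) and in the c_0 case of (ii); they fail for x = 0, e.g. with y = (1,1,1,...) in (i) and y = (1/n) in (ii), where x ⊥_B y but none of the listed conditions holds. *)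

theory Defs
  imports "HOL-Analysis.Analysis"
begin

definition seq_c :: "(nat \<Rightarrow> 'a::real_normed_field) set" where
  "seq_c = {x. convergent x}"

definition seq_c0 :: "(nat \<Rightarrow> 'a::real_normed_field) set" where
  "seq_c0 = {x. x \<longlonglongrightarrow> 0}"

definition seq_c00 :: "(nat \<Rightarrow> 'a::real_normed_field) set" where
  "seq_c00 = {x. \<forall>\<^sub>F n in sequentially. x n = 0}"

text \<open>The norm of the space of bounded sequences; it is only meaningful for bounded
  sequences, since the supremum of an unbounded set of reals is unspecified.\<close>

definition sup_norm :: "(nat \<Rightarrow> 'a::real_normed_field) \<Rightarrow> real" where
  "sup_norm x = (SUP n. norm (x n))"

text \<open>The scalar \<open>k\<close> ranges over the type of the terms of the sequences, so at type
  \<^typ>\<open>complex\<close> this is orthogonality in the complex normed space, and at type \<^typ>\<open>real\<close>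
  in the real one.\<close>

definition birkhoff_james ::
    "(nat \<Rightarrow> 'a::real_normed_field) \<Rightarrow> (nat \<Rightarrow> 'a) \<Rightarrow> bool"  (infix "\<bottom>\<^sub>B" 50) where
  "x \<bottom>\<^sub>B y \<longleftrightarrow> (\<forall>k::'a. sup_norm (\<lambda>n. x n + k * y n) \<ge> sup_norm x)"

lemma seq_c00_subset_seq_c0: "seq_c00 \<subseteq> seq_c0"
  by (auto simp: seq_c00_def seq_c0_def intro: tendsto_eventually)

lemma seq_c0_subset_seq_c: "seq_c0 \<subseteq> seq_c"
  by (auto simp: seq_c0_def seq_c_def convergent_def)

lemma seq_c_bounded: "x \<in> seq_c \<Longrightarrow> bounded (range x)"
  by (simp add: seq_c_def convergent_imp_bounded convergent_LIMSEQ_iff)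

text \<open>On bounded sequences the norm agrees with that of the library type of bounded
  continuous functions on the discrete space \<^typ>\<open>nat\<close>.\<close>

lemma sup_norm_eq_norm_Bcontfun:
  assumes "bounded (range x)"
  shows "sup_norm x = norm (Bcontfun x)"
proof -
  have "x \<in> bcontfun"
    using assms by (simp add: bcontfun_def)
  then show ?thesis
    by (simp add: sup_norm_def norm_bcontfun_def dist_bcontfun_def Bcontfun_inverse)
qed

end

theory Submission imports Defs begin

text \<open>
  A pair of convergent sequences is a continuous map from the one-point compactification of the
  naturals into pairs of scalars. Its image \<open>A\<close>, the pairs of terms together with the pair of
  limits, is compact, and the norm of \<open>x + k y\<close> is the maximum of \<open>\<bar>a + k b\<bar>\<close> over \<open>(a, b)\<close> in \<open>A\<close>.
  This absorbs the limit clauses of the theorem: \<open>lim x\<close> is one more coordinate, and it contributes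
  to the hull exactly when it attains the norm. What remains is a statement about a compact set of
  pairs (\<open>compact_norm_attained_iff_hull\<close>), based on the expansion of
  \<open>\<bar>a + k b\<bar>^2\<close> as \<open>\<bar>a\<bar>^2 + 2 inner (cnj k) (cnj a * b) + \<bar>k\<bar>^2 \<bar>b\<bar>^2\<close>.

  If \<open>0\<close> lies in the convex hull of the products \<open>cnj a * b\<close> with \<open>\<bar>a\<bar>\<close> maximal, then no \<open>k\<close> makes
  the middle term negative at all of these pairs, so that no perturbation lowers the maximum. If
  \<open>0\<close> lies outside, the hull being compact, a hyperplane separates it from \<open>0\<close>; its normal vector
  yields a \<open>k\<close> whose small positive multiples \<open>t k\<close> lower \<open>\<bar>a + t k b\<bar>\<close> near every maximizing pair,
  and by compactness the maximum itself drops.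

  For real scalars, \<open>0\<close> belongs to the hull of a set exactly when the set has a nonpositive and
  a nonnegative element, which yields the sign conditions. For null sequences the limit pair attains
  the norm only if \<open>x = 0\<close>, and then its product \<open>0\<close> already occurs among the terms.
\<close>

section \<open>Scalar fields with conjugation\<close>

text \<open>Real and complex scalars are treated together: conjugation enters as a linear involution that
  moves a scalar factor across the real inner product.\<close>

locale conjugation =
  fixes cj :: "'a::{real_normed_field, euclidean_space} \<Rightarrow> 'a"
  assumes bounded_linear_cj: "bounded_linear cj"
    and cj_cj: "cj (cj z) = z"
    and inner_mult_cj: "inner a (k * b) = inner (cj k) (cj a * b)"

interpretation real_conj: conjugation "\<lambda>z::real. z"
  by (rule conjugation.intro) (auto intro: bounded_linear_ident)

interpretation complex_conj: conjugation cnj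
  by (rule conjugation.intro) (auto intro: bounded_linear_cnj simp: inner_complex_def algebra_simps)

section \<open>Norm attainment on a compact set of pairs\<close>

context conjugation
begin

lemma norm_add_mult_squared:
  "(norm (a + k * b))\<^sup>2 = (norm a)\<^sup>2 + 2 * inner (cj k) (cj a * b) + (norm k)\<^sup>2 * (norm b)\<^sup>2"
proof -
  have "(norm (a + k * b))\<^sup>2 = (norm a)\<^sup>2 + 2 * inner a (k * b) + (norm (k * b))\<^sup>2"
    unfolding power2_norm_eq_inner by (simp add: inner_add inner_commute)
  then show ?thesis
    by (simp add: inner_mult_cj[symmetric] norm_mult power_mult_distrib)
qed

lemma continuous_on_cj_mult: "continuous_on S (\<lambda>(a, b). cj a * b)"
  unfolding case_prod_beta
  by (intro continuous_intros bounded_linear.continuous_on[OF bounded_linear_cj])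

text \<open>A linear functional that is negative on a set is negative on its hull, so it cannot be
  negative on a set whose hull contains \<open>0\<close>. Hence for each \<open>k\<close> some maximizing pair has a
  nonnegative first-order term.\<close>

lemma norm_attained_if_zero_in_hull:
  assumes "0 \<in> convex hull ((\<lambda>(a, b). cj a * b) ` {(a, b) \<in> A. norm a = M})"
  shows "\<exists>(a, b) \<in> A. M \<le> norm (a + k * b)"
proof -
  let ?P = "(\<lambda>(a, b). cj a * b) ` {(a, b) \<in> A. norm a = M}"
  have "\<not> ?P \<subseteq> {p. inner (cj k) p < 0}"
  proof
    assume "?P \<subseteq> {p. inner (cj k) p < 0}"
    then have "convex hull ?P \<subseteq> {p. inner (cj k) p < 0}"
      by (rule hull_minimal) (rule convex_halfspace_lt)
    with assms show False by auto
  qed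
  then obtain a b where ab: "(a, b) \<in> A" "norm a = M" "inner (cj k) (cj a * b) \<ge> 0"
    by (fastforce simp: not_less)
  have "(norm a)\<^sup>2 \<le> (norm (a + k * b))\<^sup>2"
    unfolding norm_add_mult_squared using ab(3) by simp
  then have "norm a \<le> norm (a + k * b)"
    by (rule power2_le_imp_le) simp
  with ab show ?thesis by auto
qed

text \<open>If perturbing in the direction of \<open>cj w\<close> by arbitrarily small amounts does not lower the
  maximum below \<open>M\<close>, then pairs attaining at least \<open>M\<close> after perturbations of size
  \<open>1/(n+1)\<close> accumulate at a maximizing pair whose first-order term is nonnegative.\<close>

lemma maximizing_pair_in_direction:
  assumes "compact A"
    and le: "\<And>a b. (a, b) \<in> A \<Longrightarrow> norm a \<le> M"
    and att: "\<And>k. \<exists>(a, b) \<in> A. M \<le> norm (a + k * b)"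
  shows "\<exists>(a, b) \<in> A. norm a = M \<and> inner w (cj a * b) \<ge> 0"
proof -
  define t where "t n = inverse (real (Suc n))" for n
  have t_pos: "t n > 0" for n by (simp add: t_def)
  have t_lim: "t \<longlonglongrightarrow> 0" unfolding t_def by (rule LIMSEQ_inverse_real_of_nat)
  define k where "k n = t n *\<^sub>R cj w" for n
  have k_lim: "k \<longlonglongrightarrow> 0"
    unfolding k_def using tendsto_scaleR[OF t_lim tendsto_const[of "cj w"]] by simp
  have cj_k: "cj (k n) = t n *\<^sub>R w" for n
    by (simp add: k_def linear_cmul[OF bounded_linear.linear[OF bounded_linear_cj]] cj_cj)
  have "\<exists>p. p \<in> A \<and> M \<le> norm (fst p + k n * snd p)" for n
    using att[of "k n"] by fastforce
  then obtain p where pA: "p n \<in> A" and pM: "M \<le> norm (fst (p n) + k n * snd (p n))" for n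
    by metis
  obtain q r where q: "q \<in> A" and r: "strict_mono (r::nat \<Rightarrow> nat)" and pr: "(p \<circ> r) \<longlonglongrightarrow> q"
    using \<open>compact A\<close> pA unfolding compact_def by metis
  have a_lim: "(\<lambda>n. fst (p (r n))) \<longlonglongrightarrow> fst q" and b_lim: "(\<lambda>n. snd (p (r n))) \<longlonglongrightarrow> snd q"
    using tendsto_fst[OF pr] tendsto_snd[OF pr] by (simp_all add: o_def)
  have tr: "(\<lambda>n. t (r n)) \<longlonglongrightarrow> 0" and kr: "(\<lambda>n. k (r n)) \<longlonglongrightarrow> 0"
    using LIMSEQ_subseq_LIMSEQ[OF t_lim r] LIMSEQ_subseq_LIMSEQ[OF k_lim r]
    by (simp_all add: o_def)
  have "(\<lambda>n. norm (fst (p (r n)) + k (r n) * snd (p (r n)))) \<longlonglongrightarrow> norm (fst q + 0 * snd q)"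
    by (intro tendsto_intros a_lim b_lim kr)
  then have "M \<le> norm (fst q)"
    using pM by (intro LIMSEQ_le_const[where X = "\<lambda>n. norm (fst (p (r n)) + k (r n) * snd (p (r n)))"]) auto
  moreover have "norm (fst q) \<le> M"
    using le q by (metis prod.collapse)
  ultimately have q_max: "norm (fst q) = M" by simp
  \<comment> \<open>The squared norm identity divided by \<open>t\<close>: the first-order term dominates up to \<open>O(t)\<close>.\<close>
  have first_order: "0 \<le> 2 * inner w (cj (fst (p n)) * snd (p n)) + t n * ((norm (cj w))\<^sup>2 * (norm (snd (p n)))\<^sup>2)"
    (is "0 \<le> ?d") for n
  proof -
    have pn: "norm (fst (p n)) \<le> M"
      using le pA[of n] by (metis prod.collapse)
    have "(norm (fst (p n)))\<^sup>2 \<le> (norm (fst (p n) + k n * snd (p n)))\<^sup>2"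
      using pM[of n] pn by (intro power_mono) auto
    then have "0 \<le> t n * ?d"
      unfolding norm_add_mult_squared cj_k using t_pos[of n]
      by (simp add: k_def power_mult_distrib power2_eq_square algebra_simps)
    then show ?thesis
      using t_pos[of n] by (simp add: zero_le_mult_iff)
  qed
  have "(\<lambda>n. 2 * inner w (cj (fst (p (r n))) * snd (p (r n)))
          + t (r n) * ((norm (cj w))\<^sup>2 * (norm (snd (p (r n))))\<^sup>2))
        \<longlonglongrightarrow> 2 * inner w (cj (fst q) * snd q) + 0 * ((norm (cj w))\<^sup>2 * (norm (snd q))\<^sup>2)"
    by (intro tendsto_intros a_lim b_lim tr bounded_linear.tendsto[OF bounded_linear_cj])
  then have "0 \<le> 2 * inner w (cj (fst q) * snd q) + 0 * ((norm (cj w))\<^sup>2 * (norm (snd q))\<^sup>2)"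
    by (rule LIMSEQ_le_const) (use first_order in auto)
  with q q_max show ?thesis
    by (intro bexI[of _ q]) (auto simp: case_prod_beta)
qed

text \<open>Birkhoff-James orthogonality with the supremum taken over a compact set of pairs of scalars.
  The forward direction tests the previous lemma against a hyperplane that separates \<open>0\<close> from the
  hull.\<close>

lemma compact_norm_attained_iff_hull:
  assumes "compact A"
    and le: "\<And>a b. (a, b) \<in> A \<Longrightarrow> norm a \<le> M"
  shows "(\<forall>k. \<exists>(a, b) \<in> A. M \<le> norm (a + k * b)) \<longleftrightarrow>
    0 \<in> convex hull ((\<lambda>(a, b). cj a * b) ` {(a, b) \<in> A. norm a = M})"
    (is "?L \<longleftrightarrow> 0 \<in> convex hull ?P")
proof
  assume att: ?L
  have "compact (A \<inter> {p. norm (fst p) = M})"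
    by (intro compact_Int_closed assms closed_Collect_eq continuous_intros)
  moreover have "A \<inter> {p. norm (fst p) = M} = {(a, b) \<in> A. norm a = M}"
    by auto
  ultimately have "compact ?P"
    by (intro compact_continuous_image continuous_on_cj_mult) simp
  then have closed: "closed (convex hull ?P)"
    by (intro compact_imp_closed compact_convex_hull)
  show "0 \<in> convex hull ?P"
  proof (rule ccontr)
    assume "0 \<notin> convex hull ?P"
    from separating_hyperplane_closed_0[OF convex_convex_hull closed this]
    obtain w c where "0 < c" and sep: "\<And>p. p \<in> convex hull ?P \<Longrightarrow> c < inner w p"
      by blast
    have "\<exists>(a, b) \<in> A. norm a = M \<and> inner (- w) (cj a * b) \<ge> 0"
      using assms att by (intro maximizing_pair_in_direction) auto
    then obtain a b where ab: "(a, b) \<in> A" "norm a = M" "inner (- w) (cj a * b) \<ge> 0"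
      by auto
    then have "cj a * b \<in> convex hull ?P"
      by (intro hull_inc) force
    from sep[OF this] ab(3) \<open>0 < c\<close> show False by simp
  qed
next
  assume "0 \<in> convex hull ?P"
  then show ?L using norm_attained_if_zero_in_hull by blast
qed

end

section \<open>Convergent sequences\<close>

lemma norm_le_sup_norm: "bounded (range x) \<Longrightarrow> norm (x n) \<le> sup_norm x"
  unfolding sup_norm_def
  by (intro cSUP_upper) (auto simp: bounded_iff intro: bdd_aboveI)

lemma norm_limit_le_sup_norm:
  assumes "x \<longlonglongrightarrow> L"
  shows "norm L \<le> sup_norm x"
  using tendsto_norm[OF assms] norm_le_sup_norm[OF convergent_imp_bounded[OF assms]]
  by (intro LIMSEQ_le_const2) auto

definition limit_closure :: "(nat \<Rightarrow> 'a::real_normed_field) \<Rightarrow> (nat \<Rightarrow> 'a) \<Rightarrow> ('a \<times> 'a) set" where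
  "limit_closure x y = insert (lim x, lim y) (range (\<lambda>n. (x n, y n)))"

lemma compact_limit_closure:
  fixes x y :: "nat \<Rightarrow> 'a::{real_normed_field, heine_borel}"
  assumes "x \<in> seq_c" "y \<in> seq_c"
  shows "compact (limit_closure x y)"
proof -
  have "(\<lambda>n. (x n, y n)) \<longlonglongrightarrow> (lim x, lim y)"
    using assms by (intro tendsto_Pair) (auto simp: seq_c_def convergent_LIMSEQ_iff)
  then show ?thesis
    unfolding limit_closure_def by (rule compact_sequence_with_limit)
qed

lemma norm_le_sup_norm_limit_closure:
  assumes "x \<in> seq_c" "y \<in> seq_c" "(a, b) \<in> limit_closure x y"
  shows "norm (a + k * b) \<le> sup_norm (\<lambda>n. x n + k * y n)"
proof -
  have lim: "(\<lambda>n. x n + k * y n) \<longlonglongrightarrow> lim x + k * lim y"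
    using assms(1,2) by (intro tendsto_intros) (auto simp: seq_c_def convergent_LIMSEQ_iff)
  from assms(3) show ?thesis
    unfolding limit_closure_def
    using norm_limit_le_sup_norm[OF lim] norm_le_sup_norm[OF convergent_imp_bounded[OF lim]]
    by auto
qed

text \<open>The supremum defining the norm of \<open>x + k y\<close> need not be attained by a term, but it is
  attained on the closure.\<close>

lemma le_sup_norm_iff:
  fixes x y :: "nat \<Rightarrow> 'a::{real_normed_field, heine_borel}"
  assumes "x \<in> seq_c" "y \<in> seq_c"
  shows "M \<le> sup_norm (\<lambda>n. x n + k * y n) \<longleftrightarrow> (\<exists>(a, b) \<in> limit_closure x y. M \<le> norm (a + k * b))"
    (is "_ \<longleftrightarrow> ?R")
proof
  assume M: "M \<le> sup_norm (\<lambda>n. x n + k * y n)"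
  have "\<exists>p \<in> limit_closure x y. \<forall>q \<in> limit_closure x y.
      norm (fst q + k * snd q) \<le> norm (fst p + k * snd p)"
    by (intro continuous_attains_sup compact_limit_closure assms continuous_intros)
      (simp add: limit_closure_def)
  then obtain p where p: "p \<in> limit_closure x y"
    and max: "\<And>q. q \<in> limit_closure x y \<Longrightarrow> norm (fst q + k * snd q) \<le> norm (fst p + k * snd p)"
    by blast
  have "norm (x n + k * y n) \<le> norm (fst p + k * snd p)" for n
    using max[of "(x n, y n)"] by (simp add: limit_closure_def)
  then have "sup_norm (\<lambda>n. x n + k * y n) \<le> norm (fst p + k * snd p)"
    unfolding sup_norm_def by (intro cSUP_least) auto
  with M p show ?R
    by (intro bexI[of _ p]) (auto simp: case_prod_beta)
next
  assume ?R
  then show "M \<le> sup_norm (\<lambda>n. x n + k * y n)"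
    using norm_le_sup_norm_limit_closure[OF assms] by (auto intro: order_trans)
qed

context conjugation
begin

theorem birkhoff_james_seq_c_iff:
  assumes "x \<in> seq_c" "y \<in> seq_c"
  shows "x \<bottom>\<^sub>B y \<longleftrightarrow>
    (if lim (\<lambda>n. norm (x n)) = sup_norm x
     then 0 \<in> convex hull ({cj (x n) * y n | n. norm (x n) = sup_norm x} \<union> {lim (\<lambda>n. cj (x n) * y n)})
     else 0 \<in> convex hull {cj (x n) * y n | n. norm (x n) = sup_norm x})"
proof -
  have x: "x \<longlonglongrightarrow> lim x" and y: "y \<longlonglongrightarrow> lim y"
    using assms by (auto simp: seq_c_def convergent_LIMSEQ_iff)
  have lims: "lim (\<lambda>n. norm (x n)) = norm (lim x)" "lim (\<lambda>n. cj (x n) * y n) = cj (lim x) * lim y"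
    by (intro limI tendsto_intros bounded_linear.tendsto[OF bounded_linear_cj] x y)+
  have le: "norm a \<le> sup_norm x" if "(a, b) \<in> limit_closure x y" for a b
    using norm_le_sup_norm_limit_closure[OF assms that, of 0] by simp
  have "x \<bottom>\<^sub>B y \<longleftrightarrow> 0 \<in> convex hull ((\<lambda>(a, b). cj a * b) ` {(a, b) \<in> limit_closure x y. norm a = sup_norm x})"
    unfolding birkhoff_james_def le_sup_norm_iff[OF assms]
    by (rule compact_norm_attained_iff_hull[OF compact_limit_closure[OF assms] le])
  also have "(\<lambda>(a, b). cj a * b) ` {(a, b) \<in> limit_closure x y. norm a = sup_norm x} =
      (if norm (lim x) = sup_norm x
       then {cj (x n) * y n | n. norm (x n) = sup_norm x} \<union> {cj (lim x) * lim y}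
       else {cj (x n) * y n | n. norm (x n) = sup_norm x})"
    by (force simp: limit_closure_def)
  finally show ?thesis unfolding lims by simp
qed

end

section \<open>Null sequences\<close>

lemma sup_norm_eq_0_iff:
  assumes "bounded (range x)"
  shows "sup_norm x = 0 \<longleftrightarrow> x = (\<lambda>n. 0)"
proof
  assume "sup_norm x = 0"
  then show "x = (\<lambda>n. 0)"
    using norm_le_sup_norm[OF assms] by (intro ext) (metis norm_le_zero_iff)
qed (simp add: sup_norm_def)

lemma lim_norm_seq_c0: "x \<in> seq_c0 \<Longrightarrow> lim (\<lambda>n. norm (x n)) = 0"
  by (intro limI) (simp add: seq_c0_def tendsto_norm_zero)

context conjugation
begin

corollary birkhoff_james_seq_c0_iff:
  assumes "x \<in> seq_c0" "y \<in> seq_c0"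
  shows "x \<bottom>\<^sub>B y \<longleftrightarrow> 0 \<in> convex hull {cj (x n) * y n | n. norm (x n) = sup_norm x}"
proof -
  have c: "x \<in> seq_c" "y \<in> seq_c"
    using assms seq_c0_subset_seq_c by auto
  show ?thesis
  proof (cases "sup_norm x = 0")
    case True
    then have "x = (\<lambda>n. 0)"
      using c sup_norm_eq_0_iff seq_c_bounded by blast
    moreover have "cj 0 = 0"
      by (rule linear_0[OF bounded_linear.linear[OF bounded_linear_cj]])
    ultimately show ?thesis
      unfolding birkhoff_james_seq_c_iff[OF c] by (simp add: sup_norm_def)
  next
    case False
    then show ?thesis
      unfolding birkhoff_james_seq_c_iff[OF c] using lim_norm_seq_c0[OF assms(1)] by simp
  qed
qed

end

section \<open>Sign conditions for real scalars\<close>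

lemma zero_in_convex_hull_real_iff:
  fixes S :: "real set"
  shows "0 \<in> convex hull S \<longleftrightarrow> 0 \<in> S \<or> (\<exists>a\<in>S. \<exists>b\<in>S. a < 0 \<and> 0 < b)"
proof
  assume hull: "0 \<in> convex hull S"
  have "\<not> S \<subseteq> {0<..}"
    using hull hull_minimal[of S "{0<..}" convex] by auto
  moreover have "\<not> S \<subseteq> {..<0}"
    using hull hull_minimal[of S "{..<0}" convex] by auto
  ultimately obtain a b where "a \<in> S" "a \<le> 0" "b \<in> S" "0 \<le> b"
    by (meson greaterThan_iff lessThan_iff not_less subsetI)
  then show "0 \<in> S \<or> (\<exists>a\<in>S. \<exists>b\<in>S. a < 0 \<and> 0 < b)"
    by (metis order_le_less)
next
  assume "0 \<in> S \<or> (\<exists>a\<in>S. \<exists>b\<in>S. a < 0 \<and> 0 < b)"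
  then show "0 \<in> convex hull S"
  proof
    assume "\<exists>a\<in>S. \<exists>b\<in>S. a < 0 \<and> 0 < b"
    then obtain a b where ab: "a \<in> S" "b \<in> S" "a < 0" "0 < b" by blast
    then have "closed_segment a b \<subseteq> convex hull S"
      by (intro closed_segment_subset hull_inc convex_convex_hull)
    with ab show ?thesis by (auto simp: closed_segment_eq_real_ivl)
  qed (rule hull_inc)
qed

lemmas birkhoff_james_seq_c_real_iff = real_conj.birkhoff_james_seq_c_iff[unfolded real_norm_def]
lemmas birkhoff_james_seq_c0_real_iff = real_conj.birkhoff_james_seq_c0_iff[unfolded real_norm_def]

text \<open>For \<open>x = 0\<close> every product vanishes although no factor \<open>y n\<close> needs to; for \<open>x \<noteq> 0\<close> a product
  at a norm-attaining index vanishes only through its second factor.\<close>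

lemma birkhoff_james_seq_c_real_sign_iff:
  fixes x y :: "nat \<Rightarrow> real"
  assumes "x \<in> seq_c" "y \<in> seq_c" "x \<noteq> (\<lambda>n. 0)"
  shows "x \<bottom>\<^sub>B y \<longleftrightarrow>
         ((\<exists>N. \<bar>x N\<bar> = sup_norm x \<and> y N = 0)
            \<or> (lim (\<lambda>n. \<bar>x n\<bar>) = sup_norm x \<and> lim y = 0))
         \<or> (\<exists>N. \<bar>x N\<bar> = lim (\<lambda>n. \<bar>x n\<bar>) \<and> lim (\<lambda>n. \<bar>x n\<bar>) = sup_norm x \<and>
              (x N * y N < 0 \<and> 0 < lim (\<lambda>n. x n * y n) \<or>
               lim (\<lambda>n. x n * y n) < 0 \<and> 0 < x N * y N))
         \<or> (\<exists>N M. \<bar>x N\<bar> = sup_norm x \<and> \<bar>x M\<bar> = sup_norm x \<and>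
              x N * y N < 0 \<and> 0 < x M * y M)"
proof -
  have x: "x \<longlonglongrightarrow> lim x" and y: "y \<longlonglongrightarrow> lim y"
    using assms(1,2) by (auto simp: seq_c_def convergent_LIMSEQ_iff)
  have lim_abs: "lim (\<lambda>n. \<bar>x n\<bar>) = \<bar>lim x\<bar>" and lim_mult: "lim (\<lambda>n. x n * y n) = lim x * lim y"
    by (intro limI tendsto_intros x y)+
  have M: "sup_norm x \<noteq> 0"
    using assms sup_norm_eq_0_iff seq_c_bounded by blast
  have zero: "a * b = 0 \<longleftrightarrow> b = 0" if "\<bar>a\<bar> = sup_norm x" for a b :: real
    using that M by auto
  define S where "S = {x n * y n | n. \<bar>x n\<bar> = sup_norm x}"
  have S0: "0 \<in> S \<longleftrightarrow> (\<exists>N. \<bar>x N\<bar> = sup_norm x \<and> y N = 0)"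
    unfolding S_def mem_Collect_eq using zero by metis
  have S_sign: "(\<exists>a\<in>S. \<exists>b\<in>S. a < 0 \<and> 0 < b) \<longleftrightarrow>
      (\<exists>N M. \<bar>x N\<bar> = sup_norm x \<and> \<bar>x M\<bar> = sup_norm x \<and> x N * y N < 0 \<and> 0 < x M * y M)"
    unfolding S_def by blast
  show ?thesis
  proof (cases "\<bar>lim x\<bar> = sup_norm x")
    case True
    have "x \<bottom>\<^sub>B y \<longleftrightarrow> 0 \<in> S \<union> {lim x * lim y} \<or>
        (\<exists>a\<in>S \<union> {lim x * lim y}. \<exists>b\<in>S \<union> {lim x * lim y}. a < 0 \<and> 0 < b)"
      unfolding birkhoff_james_seq_c_real_iff[OF assms(1,2)] lim_abs lim_mult
      using True by (simp only: simp_thms if_True S_def[symmetric] zero_in_convex_hull_real_iff)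
    also have "\<dots> \<longleftrightarrow> 0 \<in> S \<or> lim x * lim y = 0
        \<or> (\<exists>a\<in>S. a < 0 \<and> 0 < lim x * lim y \<or> lim x * lim y < 0 \<and> 0 < a)
        \<or> (\<exists>a\<in>S. \<exists>b\<in>S. a < 0 \<and> 0 < b)"
      by auto
    also have "(\<exists>a\<in>S. a < 0 \<and> 0 < lim x * lim y \<or> lim x * lim y < 0 \<and> 0 < a) \<longleftrightarrow>
        (\<exists>N. \<bar>x N\<bar> = sup_norm x \<and> (x N * y N < 0 \<and> 0 < lim x * lim y \<or> lim x * lim y < 0 \<and> 0 < x N * y N))"
      unfolding S_def by blast
    finally show ?thesis
      unfolding S0 S_sign lim_abs lim_mult zero[OF True] using True by simp
  next
    case False
    then show ?thesis
      unfolding birkhoff_james_seq_c_real_iff[OF assms(1,2)] lim_abs lim_mult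
      by (simp only: if_False S_def[symmetric] zero_in_convex_hull_real_iff S0 S_sign) simp
  qed
qed

lemma birkhoff_james_seq_c0_real_sign_iff:
  fixes x y :: "nat \<Rightarrow> real"
  assumes "x \<in> seq_c0" "y \<in> seq_c0" "x \<noteq> (\<lambda>n. 0)"
  shows "x \<bottom>\<^sub>B y \<longleftrightarrow>
         (\<exists>N. \<bar>x N\<bar> = sup_norm x \<and> y N = 0)
         \<or> (\<exists>N M. \<bar>x N\<bar> = sup_norm x \<and> \<bar>x M\<bar> = sup_norm x \<and>
              x N * y N < 0 \<and> 0 < x M * y M)"
proof -
  have c: "x \<in> seq_c" "y \<in> seq_c"
    using assms seq_c0_subset_seq_c by auto
  have "lim (\<lambda>n. \<bar>x n\<bar>) \<noteq> sup_norm x"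
    using lim_norm_seq_c0[OF assms(1)] assms(3) sup_norm_eq_0_iff[OF seq_c_bounded[OF c(1)]] by simp
  then show ?thesis
    unfolding birkhoff_james_seq_c_real_sign_iff[OF c assms(3)] by simp
qed

text \<open>If \<open>x = 0\<close>, both sides hold: every index attains the norm, and \<open>y\<close> has a zero term.\<close>

lemma birkhoff_james_seq_c00_real_sign_iff:
  fixes x y :: "nat \<Rightarrow> real"
  assumes "x \<in> seq_c00" "y \<in> seq_c00"
  shows "x \<bottom>\<^sub>B y \<longleftrightarrow>
         (\<exists>N. \<bar>x N\<bar> = sup_norm x \<and> y N = 0)
         \<or> (\<exists>N M. \<bar>x N\<bar> = sup_norm x \<and> \<bar>x M\<bar> = sup_norm x \<and>
              x N * y N < 0 \<and> 0 < x M * y M)"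
proof (cases "x = (\<lambda>n. 0)")
  case True
  obtain N where "y N = 0"
    using assms(2) by (auto simp: seq_c00_def eventually_sequentially)
  moreover have "x \<bottom>\<^sub>B y"
    unfolding birkhoff_james_seq_c0_real_iff[OF subsetD[OF seq_c00_subset_seq_c0 assms(1)]
        subsetD[OF seq_c00_subset_seq_c0 assms(2)]]
    using True by (simp add: sup_norm_def)
  ultimately show ?thesis
    using True by (auto simp: sup_norm_def)
next
  case False
  then show ?thesis
    using assms seq_c00_subset_seq_c0 by (intro birkhoff_james_seq_c0_real_sign_iff) auto
qed

section \<open>Birkhoff-James orthogonality in sequence spaces\<close>

theorem theorem2p12:
  fixes x y :: "nat \<Rightarrow> real" and u v :: "nat \<Rightarrow> complex"
  shows
    "\<comment> \<open>(i), complex scalars\<close>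
     (u \<in> seq_c \<and> v \<in> seq_c \<longrightarrow>
       (u \<bottom>\<^sub>B v \<longleftrightarrow>
         (if lim (\<lambda>n. norm (u n)) = sup_norm u
          then 0 \<in> convex hull ({cnj (u n) * v n | n. norm (u n) = sup_norm u}
                                 \<union> {lim (\<lambda>n. cnj (u n) * v n)})
          else 0 \<in> convex hull {cnj (u n) * v n | n. norm (u n) = sup_norm u})))
     \<and> \<comment> \<open>(i), real scalars\<close>
     (x \<in> seq_c \<and> y \<in> seq_c \<longrightarrow>
       (x \<bottom>\<^sub>B y \<longleftrightarrow>
         (if lim (\<lambda>n. \<bar>x n\<bar>) = sup_norm x
          then 0 \<in> convex hull ({x n * y n | n. \<bar>x n\<bar> = sup_norm x}
                                 \<union> {lim (\<lambda>n. x n * y n)})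
          else 0 \<in> convex hull {x n * y n | n. \<bar>x n\<bar> = sup_norm x})))
     \<and> \<comment> \<open>(i), the real special form\<close>
     (x \<in> seq_c \<and> y \<in> seq_c \<and> x \<noteq> (\<lambda>n. 0) \<longrightarrow>
       (x \<bottom>\<^sub>B y \<longleftrightarrow>
         ((\<exists>N. \<bar>x N\<bar> = sup_norm x \<and> y N = 0)
            \<or> (lim (\<lambda>n. \<bar>x n\<bar>) = sup_norm x \<and> lim y = 0))
         \<or> (\<exists>N. \<bar>x N\<bar> = lim (\<lambda>n. \<bar>x n\<bar>) \<and> lim (\<lambda>n. \<bar>x n\<bar>) = sup_norm x \<and>
              (x N * y N < 0 \<and> 0 < lim (\<lambda>n. x n * y n) \<or>
               lim (\<lambda>n. x n * y n) < 0 \<and> 0 < x N * y N))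
         \<or> (\<exists>N M. \<bar>x N\<bar> = sup_norm x \<and> \<bar>x M\<bar> = sup_norm x \<and>
              x N * y N < 0 \<and> 0 < x M * y M)))
     \<and> \<comment> \<open>(ii), complex scalars\<close>
     (u \<in> seq_c0 \<and> v \<in> seq_c0 \<or> u \<in> seq_c00 \<and> v \<in> seq_c00 \<longrightarrow>
       (u \<bottom>\<^sub>B v \<longleftrightarrow> 0 \<in> convex hull {cnj (u n) * v n | n. norm (u n) = sup_norm u}))
     \<and> \<comment> \<open>(ii), real scalars\<close>
     (x \<in> seq_c0 \<and> y \<in> seq_c0 \<or> x \<in> seq_c00 \<and> y \<in> seq_c00 \<longrightarrow>
       (x \<bottom>\<^sub>B y \<longleftrightarrow> 0 \<in> convex hull {x n * y n | n. \<bar>x n\<bar> = sup_norm x}))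
     \<and> \<comment> \<open>(ii), the real special form\<close>
     (x \<in> seq_c0 \<and> y \<in> seq_c0 \<and> x \<noteq> (\<lambda>n. 0) \<or> x \<in> seq_c00 \<and> y \<in> seq_c00 \<longrightarrow>
       (x \<bottom>\<^sub>B y \<longleftrightarrow>
         (\<exists>N. \<bar>x N\<bar> = sup_norm x \<and> y N = 0)
         \<or> (\<exists>N M. \<bar>x N\<bar> = sup_norm x \<and> \<bar>x M\<bar> = sup_norm x \<and>
              x N * y N < 0 \<and> 0 < x M * y M)))"
proof (intro conjI impI)
  have c0: "f \<in> seq_c0 \<and> g \<in> seq_c0" if "f \<in> seq_c0 \<and> g \<in> seq_c0 \<or> f \<in> seq_c00 \<and> g \<in> seq_c00"
    for f g :: "nat \<Rightarrow> 'b::real_normed_field"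
    using that seq_c00_subset_seq_c0 by blast
  show "u \<bottom>\<^sub>B v \<longleftrightarrow> 0 \<in> convex hull {cnj (u n) * v n | n. norm (u n) = sup_norm u}"
    if "u \<in> seq_c0 \<and> v \<in> seq_c0 \<or> u \<in> seq_c00 \<and> v \<in> seq_c00"
    using c0[OF that] complex_conj.birkhoff_james_seq_c0_iff by blast
  show "x \<bottom>\<^sub>B y \<longleftrightarrow> 0 \<in> convex hull {x n * y n | n. \<bar>x n\<bar> = sup_norm x}"
    if "x \<in> seq_c0 \<and> y \<in> seq_c0 \<or> x \<in> seq_c00 \<and> y \<in> seq_c00"
    using c0[OF that] birkhoff_james_seq_c0_real_iff by blast
qed (use complex_conj.birkhoff_james_seq_c_iff birkhoff_james_seq_c_real_iff
    birkhoff_james_seq_c_real_sign_iff birkhoff_james_seq_c0_real_sign_iff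
    birkhoff_james_seq_c00_real_sign_iff in blast)+

end
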